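(* Let $n\geq 1$ and let $w\in F_n$ be a non-empty cyclically reduced word that is not a proper power, and suppose that the cyclic presentation $P_n(w)$ is orientable. Among all pairs $(u,h)$, with $0\leq h<n$ and $u$ a subword of $w$, such that \[w=\prod_{i=0}^{n/(n,h)-1}\theta^{ih}(u),\] choose one for which the length of $u$ is least possible. Then, for the corresponding $h$, the truncation $P_{n,(n,h)}(w)$ is a concise refinement of $P_n(w)$.
   Context: $F_n$ is the free group with basis $x_0,\ldots,x_{n-1}$; subscripts are taken modulo $n$; $\theta:F_n\to F_n$ is the automorphism $\theta(x_i)=x_{i+1}$. $(a,b)$ denotes the greatest common divisor, with $(n,0)=n$ (so $(u,h)=(w,0)$ is always an admissible pair). The product is the ordered product $u\,\theta^h(u)\,\theta^{2h}(u)\cdots$. $P_n(w)=\langle x_0,\ldots,x_{n-1}\mid w,\theta(w),\ldots,\theta^{n-1}(w)\rangle$ and, for $1\leq t\leq n$, $P_{n,t}(w)=\langle x_0,\ldots,x_{n-1}\mid w,\theta(w),\ldots,\theta^{t-1}(w)\rangle$. $P_n(w)$ is orientable if $w$ is not a cyclic permutation of the inverse of any of its shifts $\theta^i(w)$, $0\leq i<n$. In a presentation $\langle X\mid R\rangle$ with cyclically reduced relators, a relator $r\in R$ is freely redundant if it is freely trivial or if there is another $s\in R$ such that $r$ is a cyclic permutation of $s$ or of $s^{-1}$. A presentation is concise if it has no freely redundant relator. A presentation $P'$ obtained from $P$ by (successively) removing freely redundant relators is a refinement of $P$; it is a concise refinement if in addition it is concise. *)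

theory Defs
  imports "HOL-Algebra.Group" "HOL-Library.Sublist"
begin

text \<open>The letter \<open>(x, True)\<close> stands for the generator \<open>x\<close>, and \<open>(x, False)\<close> for its inverse.\<close>

type_synonym 'a letter = "'a \<times> bool"
type_synonym 'a word = "'a letter list"

definition inv_letter :: "'a letter \<Rightarrow> 'a letter" where
  "inv_letter a = (fst a, \<not> snd a)"

definition inv_word :: "'a word \<Rightarrow> 'a word" where
  "inv_word w = rev (map inv_letter w)"

definition reduced :: "'a word \<Rightarrow> bool" where
  "reduced w \<longleftrightarrow> successively (\<lambda>a b. b \<noteq> inv_letter a) w"

definition cyclically_reduced :: "'a word \<Rightarrow> bool" where
  "cyclically_reduced w \<longleftrightarrow> reduced w \<and> (w \<noteq> [] \<longrightarrow> hd w \<noteq> inv_letter (last w))"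

fun cons_reduce :: "'a letter \<Rightarrow> 'a word \<Rightarrow> 'a word" where
  "cons_reduce a [] = [a]"
| "cons_reduce a (b # w) = (if b = inv_letter a then w else a # b # w)"

definition reduce :: "'a word \<Rightarrow> 'a word" where
  "reduce w = foldr cons_reduce w []"

text \<open>Elements of the free group with basis \<open>X\<close> are represented by their reduced words.\<close>

definition free_group :: "'a set \<Rightarrow> 'a word monoid" where
  "free_group X =
     \<lparr>carrier = {w. reduced w \<and> fst ` set w \<subseteq> X},
      mult = (\<lambda>v w. reduce (v @ w)),
      one = []\<rparr>"

lemma inv_letter_inv_letter [simp]: "inv_letter (inv_letter a) = a"
  by (simp add: inv_letter_def)

lemma reduced_cons_reduce: "reduced w \<Longrightarrow> reduced (cons_reduce a w)"
  by (cases w) (auto simp: reduced_def successively_Cons)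

lemma reduced_foldr_cons_reduce: "reduced w \<Longrightarrow> reduced (foldr cons_reduce v w)"
  by (induction v) (auto intro: reduced_cons_reduce)

lemma reduced_reduce: "reduced (reduce w)"
  unfolding reduce_def by (rule reduced_foldr_cons_reduce) (simp add: reduced_def)

lemma reduce_reduced: "reduced w \<Longrightarrow> reduce w = w"
proof (induction w)
  case (Cons a w)
  then show ?case
    by (cases w) (auto simp: reduced_def reduce_def)
qed (simp add: reduce_def)

lemma cons_reduce_inv_letter:
  assumes "reduced w"
  shows "cons_reduce a (cons_reduce (inv_letter a) w) = w"
proof (cases w)
  case (Cons b v)
  with assms show ?thesis
    by (cases v) (auto simp: reduced_def)
qed simp

lemma foldr_cons_reduce_cons_reduce:
  assumes "reduced w"
  shows "foldr cons_reduce (cons_reduce a v) w = cons_reduce a (foldr cons_reduce v w)"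
proof (cases v)
  case (Cons b v')
  with assms show ?thesis
    using cons_reduce_inv_letter[OF reduced_foldr_cons_reduce[OF assms], of a v'] by auto
qed simp

lemma foldr_cons_reduce_reduce:
  "reduced w \<Longrightarrow> foldr cons_reduce (reduce v) w = foldr cons_reduce v w"
  by (induction v) (simp_all add: reduce_def foldr_cons_reduce_cons_reduce)

lemma reduce_append: "reduce (v @ w) = foldr cons_reduce v (reduce w)"
  by (simp add: reduce_def)

lemma reduce_append_reduce_left [simp]: "reduce (reduce v @ w) = reduce (v @ w)"
  by (simp add: reduce_append foldr_cons_reduce_reduce reduced_reduce)

lemma reduce_append_reduce_right [simp]: "reduce (v @ reduce w) = reduce (v @ w)"
  by (simp add: reduce_append reduce_reduced reduced_reduce)

lemma reduce_inv_word_append: "reduce (inv_word w @ w) = []"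
proof (induction w)
  case (Cons a w)
  have "reduce (inv_word (a # w) @ a # w)
      = foldr cons_reduce (inv_word w) (cons_reduce (inv_letter a) (cons_reduce a (reduce w)))"
    by (simp add: inv_word_def reduce_def)
  also have "\<dots> = reduce (inv_word w @ w)"
    using cons_reduce_inv_letter[OF reduced_reduce, of "inv_letter a" w]
    by (simp add: reduce_append)
  finally show ?case using Cons.IH by simp
qed (simp add: reduce_def inv_word_def)

lemma fst_set_reduce: "fst ` set (reduce w) \<subseteq> fst ` set w"
proof (induction w)
  case (Cons a w)
  have "reduce (a # w) = cons_reduce a (reduce w)"
    by (simp add: reduce_def)
  moreover have "fst ` set (cons_reduce a v) \<subseteq> insert (fst a) (fst ` set v)" for v
    by (cases v) (simp_all add: subset_insertI2 subset_insertI insert_mono)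
  ultimately have "fst ` set (reduce (a # w)) \<subseteq> insert (fst a) (fst ` set (reduce w))"
    by simp
  also have "\<dots> \<subseteq> insert (fst a) (fst ` set w)"
    using Cons.IH by (rule insert_mono)
  finally show ?case by simp
qed (simp add: reduce_def)

lemma group_free_group: "group (free_group X)"
proof (rule groupI)
  fix v w assume "v \<in> carrier (free_group X)" "w \<in> carrier (free_group X)"
  then show "v \<otimes>\<^bsub>free_group X\<^esub> w \<in> carrier (free_group X)"
    using fst_set_reduce[of "v @ w"] by (simp add: free_group_def reduced_reduce image_Un order.trans)
next
  fix w assume w: "w \<in> carrier (free_group X)"
  have "fst ` set (inv_word w) = fst ` set w"
    by (force simp: inv_word_def inv_letter_def)
  with w have "reduce (inv_word w) \<in> carrier (free_group X)"
    using fst_set_reduce[of "inv_word w"] by (simp add: free_group_def reduced_reduce order.trans)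
  moreover have "reduce (inv_word w) \<otimes>\<^bsub>free_group X\<^esub> w = \<one>\<^bsub>free_group X\<^esub>"
    by (simp add: free_group_def reduce_inv_word_append)
  ultimately show "\<exists>y\<in>carrier (free_group X). y \<otimes>\<^bsub>free_group X\<^esub> w = \<one>\<^bsub>free_group X\<^esub>" ..
qed (auto simp: free_group_def reduce_reduced reduced_def)

definition proper_power :: "('a, 'b) monoid_scheme \<Rightarrow> 'a \<Rightarrow> bool" where
  "proper_power G w \<longleftrightarrow> (\<exists>v \<in> carrier G. \<exists>k::nat. k \<ge> 2 \<and> w = v [^]\<^bsub>G\<^esub> k)"

definition cyclic_permutation :: "'a list \<Rightarrow> 'a list \<Rightarrow> bool" where
  "cyclic_permutation v w \<longleftrightarrow> (\<exists>k. v = rotate k w)"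

record 'a presentation =
  generators :: "'a set"
  relators :: "'a word set"

definition freely_redundant :: "'a presentation \<Rightarrow> 'a word \<Rightarrow> bool" where
  "freely_redundant P r \<longleftrightarrow> r \<in> relators P \<and>
     (reduce r = [] \<or>
      (\<exists>s \<in> relators P. s \<noteq> r \<and> (cyclic_permutation r s \<or> cyclic_permutation r (inv_word s))))"

definition concise :: "'a presentation \<Rightarrow> bool" where
  "concise P \<longleftrightarrow> (\<forall>r \<in> relators P. \<not> freely_redundant P r)"

definition remove_relator :: "'a presentation \<Rightarrow> 'a word \<Rightarrow> 'a presentation" where
  "remove_relator P r = P\<lparr>relators := relators P - {r}\<rparr>"

definition removes_redundant :: "'a presentation \<Rightarrow> 'a presentation \<Rightarrow> bool" where
  "removes_redundant P P' \<longleftrightarrow>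
     (\<exists>r. freely_redundant P r \<and> P' = P\<lparr>relators := relators P - {r}\<rparr>)"

definition refinement :: "'a presentation \<Rightarrow> 'a presentation \<Rightarrow> bool" where
  "refinement P' P \<longleftrightarrow> removes_redundant\<^sup>*\<^sup>* P P'"

definition concise_refinement :: "'a presentation \<Rightarrow> 'a presentation \<Rightarrow> bool" where
  "concise_refinement P' P \<longleftrightarrow> refinement P' P \<and> concise P'"

text \<open>The generator \<open>x\<^sub>i\<close> of \<open>F\<^sub>n\<close> is the number \<open>i < n\<close>.\<close>

abbreviation F :: "nat \<Rightarrow> nat word monoid" where
  "F n \<equiv> free_group {..<n}"

definition shift :: "nat \<Rightarrow> nat word \<Rightarrow> nat word" where
  "shift n w = map (\<lambda>(i, e). (Suc i mod n, e)) w"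

lemma inj_on_Suc_mod: "inj_on (\<lambda>i. Suc i mod n) {..<n}"
  by (auto simp: inj_on_def mod_Suc split: if_splits)

lemma shift_cons_reduce:
  assumes "fst a < n" "fst ` set w \<subseteq> {..<n}"
  shows "shift n (cons_reduce a w) = cons_reduce (Suc (fst a) mod n, snd a) (shift n w)"
proof (cases w)
  case (Cons b v)
  with assms have "Suc (fst b) mod n = Suc (fst a) mod n \<longleftrightarrow> fst b = fst a"
    by (intro inj_on_eq_iff[OF inj_on_Suc_mod]) auto
  with Cons show ?thesis
    by (auto simp: shift_def inv_letter_def prod_eq_iff split: prod.splits)
qed (simp add: shift_def split: prod.splits)

lemma shift_reduce:
  "fst ` set w \<subseteq> {..<n} \<Longrightarrow> shift n (reduce w) = reduce (shift n w)"
proof (induction w)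
  case (Cons a w)
  then have "shift n (cons_reduce a (reduce w)) =
      cons_reduce (Suc (fst a) mod n, snd a) (shift n (reduce w))"
    using fst_set_reduce[of w] by (intro shift_cons_reduce) auto
  with Cons show ?case
    by (simp add: reduce_def shift_def split: prod.splits)
qed (simp add: reduce_def shift_def)

lemma shift_iso: "shift n \<in> iso (F n) (F n)"
proof -
  let ?f = "\<lambda>(i, e :: bool). (Suc i mod n, e)"
  have mem: "w \<in> carrier (F n) \<longleftrightarrow> reduce w = w \<and> set w \<subseteq> {..<n} \<times> UNIV" for w
    using reduced_reduce[of w] by (auto simp: free_group_def reduce_reduced)
  have ext: "fst ` set w \<subseteq> {..<n} \<longleftrightarrow> set w \<subseteq> {..<n} \<times> UNIV" for w :: "nat word"
    by auto
  have bij: "bij_betw ?f ({..<n} \<times> UNIV) ({..<n} \<times> UNIV)"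
  proof -
    have "(\<lambda>i. Suc i mod n) ` {..<n} = {..<n}"
      by (intro endo_inj_surj inj_on_Suc_mod) auto
    with inj_on_Suc_mod[of n] have "bij_betw (\<lambda>i. Suc i mod n) {..<n} {..<n}"
      by (simp add: bij_betw_def)
    then have "bij_betw (map_prod (\<lambda>i. Suc i mod n) id) ({..<n} \<times> UNIV) ({..<n} \<times> (UNIV :: bool set))"
      by (intro bij_betw_map_prod) (auto simp: bij_betw_def)
    moreover have "map_prod (\<lambda>i. Suc i mod n) id = ?f"
      by (auto simp: fun_eq_iff)
    ultimately show ?thesis by simp
  qed
  have closed: "shift n w \<in> carrier (F n)" if "w \<in> carrier (F n)" for w
  proof -
    have w: "reduce w = w" "set w \<subseteq> {..<n} \<times> UNIV"
      using that unfolding mem by auto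
    from w(2) have "set (shift n w) \<subseteq> {..<n} \<times> UNIV"
      using bij_betw_imp_surj_on[OF bij] unfolding shift_def set_map by blast
    moreover have "reduce (shift n w) = shift n w"
      using w shift_reduce[of w n] by (simp only: ext)
    ultimately show ?thesis
      unfolding mem by simp
  qed
  have "inj_on (shift n) (carrier (F n))"
  proof (rule inj_onI)
    fix v w assume "v \<in> carrier (F n)" "w \<in> carrier (F n)" "shift n v = shift n w"
    then show "v = w"
      using inj_on_map_eq_map[of ?f v w] inj_on_subset[OF bij_betw_imp_inj_on[OF bij], of "set v \<union> set w"]
      by (simp add: mem shift_def)
  qed
  moreover have "carrier (F n) \<subseteq> shift n ` carrier (F n)"
  proof
    fix w assume w: "w \<in> carrier (F n)"
    have "w \<in> lists (?f ` ({..<n} \<times> UNIV))"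
      using w unfolding bij_betw_imp_surj_on[OF bij] mem lists_eq_set by blast
    then have "w \<in> map ?f ` lists ({..<n} \<times> UNIV)"
      by (simp only: lists_image)
    then obtain v where v: "set v \<subseteq> {..<n} \<times> UNIV" "w = shift n v"
      unfolding shift_def lists_eq_set by blast
    have "shift n (reduce v) = shift n v"
      using v w shift_reduce[of v n] by (simp add: mem ext)
    moreover have "reduce v \<in> carrier (F n)"
      using order.trans[OF fst_set_reduce] v(1) unfolding ext[symmetric]
      by (simp add: free_group_def reduced_reduce)
    ultimately show "w \<in> shift n ` carrier (F n)"
      using v by (metis imageI)
  qed
  moreover have "shift n \<in> hom (F n) (F n)"
  proof (rule homI)
    fix v w assume "v \<in> carrier (F n)" "w \<in> carrier (F n)"
    then show "shift n (v \<otimes>\<^bsub>F n\<^esub> w) = shift n v \<otimes>\<^bsub>F n\<^esub> shift n w"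
      using shift_reduce[of "v @ w" n] by (auto simp: free_group_def shift_def)
  qed (rule closed)
  ultimately show ?thesis
    using closed by (auto simp: iso_def bij_betw_def)
qed

text \<open>Relators form a set.  For \<open>w \<noteq> []\<close> the shifts of \<open>w\<close> by \<open>0, \<dots>, n - 1\<close> are pairwise
  distinct words, so no repeated relator is lost.\<close>

definition truncated_presentation :: "nat \<Rightarrow> nat \<Rightarrow> nat word \<Rightarrow> nat presentation" where
  "truncated_presentation n t w =
     \<lparr>generators = {..<n}, relators = {(shift n ^^ i) w | i. i < t}\<rparr>"

definition cyclic_presentation :: "nat \<Rightarrow> nat word \<Rightarrow> nat presentation" where
  "cyclic_presentation n w =
     \<lparr>generators = {..<n}, relators = {(shift n ^^ i) w | i. i < n}\<rparr>"

text \<open>Orientability of \<^term>\<open>cyclic_presentation n w\<close>.\<close>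

definition orientable :: "nat \<Rightarrow> nat word \<Rightarrow> bool" where
  "orientable n w \<longleftrightarrow>
     (\<forall>i<n. \<not> cyclic_permutation w (inv_word ((shift n ^^ i) w)))"

definition shift_product :: "nat \<Rightarrow> nat \<Rightarrow> nat word \<Rightarrow> nat word" where
  "shift_product n h u =
     foldr (\<otimes>\<^bsub>F n\<^esub>) (map (\<lambda>i. (shift n ^^ (i * h)) u) [0..<n div gcd n h]) \<one>\<^bsub>F n\<^esub>"

definition admissible :: "nat \<Rightarrow> nat word \<Rightarrow> nat word \<times> nat \<Rightarrow> bool" where
  "admissible n w = (\<lambda>(u, h). h < n \<and> sublist u w \<and> w = shift_product n h u)"

end

theory Submission
  imports Defs "HOL-Number_Theory.Cong"
begin

text \<open>
  The indices \<open>i\<close> for which \<open>\<theta>\<^sup>i(w)\<close> is a cyclic permutation of \<open>w\<close> are the multiples of a divisor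
  \<open>d\<close> of \<open>n\<close>.  Since \<open>w\<close> is primitive, the least \<open>K > 0\<close> such that rotating \<open>w\<close> by \<open>K\<close> gives a shift
  \<open>\<theta>\<^sup>h\<^sup>'(w)\<close> divides the length of \<open>w\<close>, and the prefix of length \<open>K\<close> with \<open>h'\<close> is an admissible pair
  such that \<open>(n, h') = d\<close>.  Conversely, an admissible pair \<open>(u, h)\<close> makes \<open>\<theta>\<^sup>h(w)\<close> conjugate to \<open>w\<close> by
  \<open>u\<close>, so \<open>d\<close> divides \<open>(n, h)\<close>, and comparing lengths forces \<open>(n, h) \<le> d\<close> when \<open>u\<close> is shortest;
  cancellation in the product only helps here.  Orientability excludes coincidences with inverses.
\<close>

section \<open>Conjugate cyclically reduced words\<close>

lemma reduce_Cons: "reduce (a # v) = cons_reduce a (reduce v)"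
  by (simp add: reduce_def)

lemma reduce_Cons_inv_letter: "reduce (inv_letter a # a # v) = reduce v"
  using cons_reduce_inv_letter[OF reduced_reduce, of "inv_letter a" v] by (simp add: reduce_Cons)

lemma reduce_Cons_cancel: "reduce (a # v) = reduce (a # w) \<longleftrightarrow> reduce v = reduce w"
  by (metis reduce_Cons reduce_Cons_inv_letter)

lemma length_reduce_le: "length (reduce w) \<le> length w"
proof (induction w)
  case (Cons a w)
  have "length (cons_reduce a v) \<le> Suc (length v)" for v
    by (cases v) auto
  with Cons show ?case
    by (metis reduce_Cons Suc_le_mono le_trans length_Cons)
qed (simp add: reduce_def)

lemma reduced_append:
  "reduced (v @ w) \<longleftrightarrow>
     reduced v \<and> reduced w \<and> (v \<noteq> [] \<longrightarrow> w \<noteq> [] \<longrightarrow> hd w \<noteq> inv_letter (last v))"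
  by (auto simp: reduced_def successively_append_iff)

lemma reduced_Cons: "reduced (a # w) \<longleftrightarrow> reduced w \<and> (w \<noteq> [] \<longrightarrow> hd w \<noteq> inv_letter a)"
  using reduced_append[of "[a]" w] by (auto simp: reduced_def)

lemma inv_letter_eq_iff: "inv_letter a = b \<longleftrightarrow> a = inv_letter b"
  by (metis inv_letter_inv_letter)

lemma inv_word_Cons: "inv_word (a # w) = inv_word w @ [inv_letter a]"
  by (simp add: inv_word_def)

lemma last_inv_word: "w \<noteq> [] \<Longrightarrow> last (inv_word w) = inv_letter (hd w)"
  by (cases w) (simp_all add: inv_word_Cons)

lemma hd_inv_word: "w \<noteq> [] \<Longrightarrow> hd (inv_word w) = inv_letter (last w)"
  by (simp add: inv_word_def hd_rev last_map)

lemma inv_word_eq_Nil_iff: "inv_word w = [] \<longleftrightarrow> w = []"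
  by (simp add: inv_word_def)

lemma reduced_inv_word: "reduced w \<Longrightarrow> reduced (inv_word w)"
proof (induction w)
  case (Cons a w)
  then show ?case
    by (cases "w = []")
      (auto simp: inv_word_Cons reduced_append reduced_Cons last_inv_word inv_word_eq_Nil_iff
        inv_letter_eq_iff, simp_all add: inv_word_def reduced_def)
qed (simp add: reduced_def inv_word_def)

lemma cyclically_reduced_rotate1:
  "cyclically_reduced (a # w) \<longleftrightarrow> cyclically_reduced (w @ [a])"
  by (cases "w = []")
    (auto simp: cyclically_reduced_def reduced_Cons reduced_append inv_letter_eq_iff, simp add: reduced_def)

text \<open>Induction on the conjugator: if its first letter \<open>a\<close> cancels against the
  start or the end of \<open>w\<close>, replacing \<open>w\<close> by a rotation by one letter
  absorbs \<open>a\<close>. If neither happens, the conjugate of \<open>w\<close> by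
  \<open>a # g\<close> is reduced as written, and its two outer letters are mutually inverse, which
  the cyclic reducedness of \<open>v\<close> forbids.\<close>

lemma conjugate_cyclically_reduced:
  assumes "cyclically_reduced w" "w \<noteq> []" "cyclically_reduced v" "reduced g"
    and "reduce (w @ g) = reduce (g @ v)"
  shows "\<exists>k. v = rotate k w"
  using assms
proof (induction g arbitrary: w)
  case Nil
  then have "w = v"
    by (simp add: cyclically_reduced_def reduce_reduced)
  then show ?case
    by (metis rotate0 id_apply)
next
  case (Cons a g)
  have g: "reduced g"
    using Cons.prems(4) by (simp add: reduced_Cons)
  consider "hd w = a" | "last w = inv_letter a" | "hd w \<noteq> a" "last w \<noteq> inv_letter a"
    by blast
  then show ?case
  proof cases
    case 1
    with Cons.prems(2) obtain w' where w: "w = a # w'"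
      by (cases w) auto
    have "reduce ((w' @ [a]) @ g) = reduce (g @ v)"
      using Cons.prems(5) by (simp add: w reduce_Cons_cancel)
    moreover have "cyclically_reduced (w' @ [a])"
      using Cons.prems(1) by (simp add: w cyclically_reduced_rotate1)
    ultimately obtain k where "v = rotate k (w' @ [a])"
      using Cons.IH[of "w' @ [a]"] Cons.prems(3) g by auto
    then have "v = rotate (Suc k) w"
      by (simp add: w rotate1_rotate_swap)
    then show ?thesis ..
  next
    case 2
    with Cons.prems(2) obtain w' where w: "w = w' @ [inv_letter a]"
      by (metis append_butlast_last_id)
    have "reduce (w @ a # g) = reduce (w' @ g)"
      by (metis w append.assoc append_Cons append_Nil reduce_Cons_inv_letter reduce_append_reduce_right)
    \<comment> \<open>Both sides of the conjugacy equation are multiplied on the left by the inverse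
      of \<open>a\<close>.\<close>
    then have "reduce ((inv_letter a # w') @ g) = reduce (inv_letter a # reduce (a # g @ v))"
      using Cons.prems(5) by (simp add: reduce_Cons reduce_reduced[OF reduced_reduce] reduced_cons_reduce)
    also have "\<dots> = reduce (g @ v)"
      by (metis reduce_Cons reduce_Cons_inv_letter reduce_reduced reduced_reduce)
    finally have "reduce ((inv_letter a # w') @ g) = reduce (g @ v)" .
    moreover have "cyclically_reduced (inv_letter a # w')"
      using Cons.prems(1) by (simp add: w cyclically_reduced_rotate1)
    ultimately obtain k where k: "v = rotate k (inv_letter a # w')"
      using Cons.IH[of "inv_letter a # w'"] Cons.prems(3) g by auto
    have "inv_letter a # w' = rotate (length w') w"
      by (simp add: w rotate_append)
    with k show ?thesis
      by (metis rotate_rotate)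
  next
    case 3
    let ?g = "a # g"
    \<comment> \<open>The case assumptions exclude cancellation at both seams.\<close>
    have red: "reduced (inv_word ?g @ w @ ?g)"
      using 3 Cons.prems(1,2,4) reduced_inv_word[OF Cons.prems(4)]
      by (auto simp: reduced_append cyclically_reduced_def last_inv_word hd_append inv_letter_eq_iff)
    have "inv_word ?g @ w @ ?g = reduce (inv_word ?g @ reduce (w @ ?g))"
      using red by (simp add: reduce_reduced)
    also have "\<dots> = reduce (reduce (inv_word ?g @ ?g) @ v)"
      unfolding Cons.prems(5) by simp
    also have "\<dots> = v"
      using Cons.prems(3) unfolding reduce_inv_word_append
      by (simp add: reduce_reduced cyclically_reduced_def)
    finally have v: "v = inv_word ?g @ w @ ?g" ..
    then have "hd v = inv_letter (last v)"
      using hd_inv_word[of ?g] by (simp add: inv_word_eq_Nil_iff)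
    moreover have "v \<noteq> []"
      by (simp add: v)
    ultimately show ?thesis
      using Cons.prems(3) by (simp add: cyclically_reduced_def)
  qed
qed

section \<open>Shifts, rotations and proper powers\<close>

lemma shift_eq_map: "shift n w = map (\<lambda>a. (Suc (fst a) mod n, snd a)) w"
  by (simp add: shift_def case_prod_beta')

lemma funpow_shift_eq_map:
  assumes "fst ` set w \<subseteq> {..<n}"
  shows "(shift n ^^ i) w = map (\<lambda>a. ((fst a + i) mod n, snd a)) w"
proof (induction i)
  case 0
  show ?case
    using assms by (auto intro!: map_idI[symmetric])
next
  case (Suc i)
  then show ?case
    by (simp add: shift_eq_map mod_Suc_eq)
qed

lemma funpow_shift_append: "(shift n ^^ i) (v @ w) = (shift n ^^ i) v @ (shift n ^^ i) w"
  by (induction i) (simp_all add: shift_eq_map)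

lemma funpow_shift_concat: "(shift n ^^ i) (concat ws) = concat (map (shift n ^^ i) ws)"
proof (induction ws)
  case Nil
  show ?case by (induction i) (simp_all add: shift_eq_map)
qed (simp add: funpow_shift_append)

lemma length_funpow_shift [simp]: "length ((shift n ^^ i) w) = length w"
  by (induction i) (simp_all add: shift_eq_map)

lemma funpow_shift_rotate: "(shift n ^^ i) (rotate k w) = rotate k ((shift n ^^ i) w)"
  by (induction i) (simp_all add: shift_eq_map rotate_map)

lemma funpow_shift_take: "(shift n ^^ i) (take k w) = take k ((shift n ^^ i) w)"
  by (induction i) (simp_all add: shift_eq_map take_map)

lemma funpow_shift_inv_word: "(shift n ^^ i) (inv_word w) = inv_word ((shift n ^^ i) w)"
  by (induction i) (simp_all add: shift_eq_map inv_word_def rev_map inv_letter_def)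

lemma funpow_shift_carrier: "w \<in> carrier (F n) \<Longrightarrow> (shift n ^^ i) w \<in> carrier (F n)"
  using shift_iso[of n] by (induction i) (auto simp: iso_def hom_def)

lemma letters_carrier: "w \<in> carrier (F n) \<Longrightarrow> fst ` set w \<subseteq> {..<n}"
  by (simp add: free_group_def)

lemma reduced_carrier: "w \<in> carrier (F n) \<Longrightarrow> reduced w"
  by (simp add: free_group_def)

text \<open>The index of the first letter already determines the shift modulo
  \<open>n\<close>.\<close>

lemma funpow_shift_eq_iff:
  assumes "fst ` set w \<subseteq> {..<n}" "w \<noteq> []"
  shows "(shift n ^^ i) w = (shift n ^^ j) w \<longleftrightarrow> [i = j] (mod n)"
proof
  assume "(shift n ^^ i) w = (shift n ^^ j) w"
  then have "(fst (hd w) + i) mod n = (fst (hd w) + j) mod n"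
    using assms by (cases w) (simp_all add: funpow_shift_eq_map)
  then show "[i = j] (mod n)"
    using cong_add_lcancel_nat[of "fst (hd w)" i j n] by (simp add: cong_def)
next
  assume "[i = j] (mod n)"
  then have "[x + i = x + j] (mod n)" for x
    by (simp add: cong_add_lcancel_nat)
  then show "(shift n ^^ i) w = (shift n ^^ j) w"
    using assms by (simp add: funpow_shift_eq_map cong_def)
qed

lemma funpow_shift_cong:
  assumes "fst ` set w \<subseteq> {..<n}" "[i = j] (mod n)"
  shows "(shift n ^^ i) w = (shift n ^^ j) w"
  using assms funpow_shift_eq_iff[OF assms(1)] by (cases "w = []") (simp_all add: funpow_shift_eq_map)

lemma funpow_shift_reduce:
  assumes "fst ` set w \<subseteq> {..<n}"
  shows "(shift n ^^ i) (reduce w) = reduce ((shift n ^^ i) w)"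
\<comment> \<open>For \<open>n = 0\<close> there are no letters. Otherwise shifting keeps the
  indices below \<open>n\<close>, as the induction requires.\<close>
proof (cases "n = 0")
  case True
  with assms have "w = []"
    by auto
  then show ?thesis
    by (simp add: funpow_shift_eq_map reduce_def)
next
  case False
  show ?thesis
  proof (induction i)
    case (Suc i)
    have "fst ` set ((shift n ^^ i) w) \<subseteq> {..<n}"
      using False assms by (auto simp: funpow_shift_eq_map)
    with Suc show ?case
      by (simp add: shift_reduce)
  qed simp
qed

lemma cyclically_reduced_funpow_shift:
  assumes "w \<in> carrier (F n)" "cyclically_reduced w"
  shows "cyclically_reduced ((shift n ^^ i) w)"
proof (cases "w = []")
  case False
  let ?f = "\<lambda>a :: nat letter. ((fst a + i) mod n, snd a)"
  have lt: "fst (hd w) < n" "fst (last w) < n"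
    using False letters_carrier[OF assms(1)] hd_in_set last_in_set by blast+
  \<comment> \<open>Shifting is injective on indices below \<open>n\<close>, so an inverse pair at
    the two ends of the shifted word was already one in \<open>w\<close>.\<close>
  have "fst (hd w) = fst (last w)" if "(fst (hd w) + i) mod n = (fst (last w) + i) mod n"
    using that lt cong_add_rcancel_nat[of "fst (hd w)" i "fst (last w)" n] by (simp add: cong_def)
  then have "?f (hd w) = inv_letter (?f (last w)) \<Longrightarrow> hd w = inv_letter (last w)"
    by (auto simp: inv_letter_def prod_eq_iff)
  then show ?thesis
    using assms False reduced_carrier[OF funpow_shift_carrier[OF assms(1), of i]]
    by (auto simp: cyclically_reduced_def funpow_shift_eq_map[OF letters_carrier[OF assms(1)]]
        hd_map last_map)
qed (simp add: cyclically_reduced_def reduced_def funpow_shift_eq_map)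

section \<open>Powers, and rotations that fix a word\<close>

lemma free_group_pow:
  "v [^]\<^bsub>free_group X\<^esub> (k::nat) = reduce (concat (replicate k v))"
proof (induction k)
  case 0
  show ?case by (simp add: free_group_def reduce_def)
next
  case (Suc k)
  \<comment> \<open>The group power adds its new factor on the right, \<open>replicate\<close> on
    the left.\<close>
  have "concat (replicate k v) @ v = v @ concat (replicate k v)"
    by (induction k) auto
  with Suc show ?case
    by (simp add: free_group_def)
qed

text \<open>A rotation fixing \<open>w\<close> splits it into two commuting factors, and commuting
  words are powers of a common word \<open>z\<close>. If both factors are non-empty,
  \<open>w\<close> is at least a square of \<open>z\<close>.\<close>

lemma rotate_eq_self_iff_dvd:
  assumes "w \<in> carrier (F n)" "w \<noteq> []" "\<not> proper_power (F n) w"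
  shows "rotate k w = w \<longleftrightarrow> length w dvd k"
proof
  assume "rotate k w = w"
  then have "drop (k mod length w) w @ take (k mod length w) w =
      take (k mod length w) w @ drop (k mod length w) w"
    by (simp add: rotate_drop_take)
  then obtain a b z where z: "concat (replicate a z) = drop (k mod length w) w"
      "concat (replicate b z) = take (k mod length w) w"
    by (metis comm_append_are_replicate)
  then have w: "w = concat (replicate (b + a) z)"
    by (simp add: replicate_add)
  show "length w dvd k"
  proof (rule ccontr)
    assume "\<not> length w dvd k"
    then have "0 < k mod length w" "k mod length w < length w"
      using assms(2) by (auto simp: mod_greater_zero_iff_not_dvd)
    then have "take (k mod length w) w \<noteq> []" "drop (k mod length w) w \<noteq> []"
      by auto
    then have "a \<noteq> 0" "b \<noteq> 0"
      using z by (metis replicate_0 concat.simps(1))+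
    then obtain c where c: "b + a = Suc c" "c \<ge> 1"
      by (cases b) auto
    \<comment> \<open>As a prefix of \<open>w\<close>, the root \<open>z\<close> is itself reduced
      and so an element of the free group.\<close>
    then have "w = z @ concat (replicate c z)"
      using w by simp
    then have "z \<in> carrier (F n)"
      using assms(1) unfolding free_group_def by (auto simp: reduced_append)
    moreover have "w = z [^]\<^bsub>F n\<^esub> (b + a)"
      using reduce_reduced[OF reduced_carrier[OF assms(1)]] w by (simp add: free_group_pow)
    moreover have "b + a \<ge> 2"
      using c by simp
    ultimately show False
      using assms(3) unfolding proper_power_def by blast
  qed
next
  assume "length w dvd k"
  then show "rotate k w = w"
    by (simp add: rotate_drop_take)
qed

section \<open>Products of shifts and admissible pairs\<close>

lemma shift_product_eq_reduce:
  "shift_product n h u = reduce (concat (map (\<lambda>i. (shift n ^^ (i * h)) u) [0..<n div gcd n h]))"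
proof -
  have "foldr (\<otimes>\<^bsub>F n\<^esub>) ws \<one>\<^bsub>F n\<^esub> = reduce (concat ws)" for ws
    by (induction ws) (simp_all add: free_group_def reduce_def[of "[]"])
  then show ?thesis
    by (simp add: shift_product_def)
qed

lemma length_shift_product_le: "length (shift_product n h u) \<le> n div gcd n h * length u"
proof -
  have "length (concat (map (\<lambda>i. (shift n ^^ (i * h)) u) [0..<m])) = m * length u" for m
    by (induction m) simp_all
  then show ?thesis
    using length_reduce_le by (metis shift_product_eq_reduce)
qed

text \<open>Applying \<open>shift n ^^ h\<close> moves every factor of the product one place on,
  cyclically, which is conjugation by \<open>u\<close>. Conjugate cyclically reduced words are
  rotations of each other.\<close>

lemma admissible_imp_rotate:
  assumes "w \<in> carrier (F n)" "w \<noteq> []" "cyclically_reduced w" "admissible n w (u, h)"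
  shows "\<exists>k. (shift n ^^ h) w = rotate k w"
proof -
  define m where "m = n div gcd n h"
  define U where "U i = (shift n ^^ (i * h)) u" for i
  \<comment> \<open>Being a subword of \<open>w\<close> makes \<open>u\<close> reduced, as the
    conjugator has to be.\<close>
  obtain ps ss where "w = ps @ u @ ss"
    using assms(4) by (auto simp: admissible_def sublist_def)
  then have u: "reduced u" "fst ` set u \<subseteq> {..<n}"
    using assms(1) by (simp_all add: free_group_def reduced_append image_Un)
  have w: "w = reduce (concat (map U [0..<m]))"
    using assms(4) by (simp add: admissible_def shift_product_eq_reduce m_def U_def [abs_def])
  \<comment> \<open>\<open>m * h\<close> is the least common multiple of \<open>n\<close> and
    \<open>h\<close>, so the factor after the last one is \<open>u\<close> again.\<close>
  have "n dvd m * h"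
    by (metis m_def dvd_def div_mult_swap dvd_div_mult gcd_dvd1 gcd_dvd2)
  then have Um: "U m = u"
    using funpow_shift_cong[OF u(2), of "m * h" 0] by (simp add: U_def cong_0_iff)
  have "n > 0"
    using assms(4) by (auto simp: admissible_def)
  then have letters: "fst ` set (concat (map U [0..<m])) \<subseteq> {..<n}"
    using u(2) by (auto simp: U_def funpow_shift_eq_map)
  have "(shift n ^^ h) (concat (map U [0..<m])) = concat (map (\<lambda>i. U (Suc i)) [0..<m])"
    by (simp add: funpow_shift_concat U_def funpow_add comp_def)
  then have "(shift n ^^ h) w = reduce (concat (map (\<lambda>i. U (Suc i)) [0..<m]))"
    unfolding w using funpow_shift_reduce[OF letters] by simp
  moreover have "u @ concat (map (\<lambda>i. U (Suc i)) [0..<m]) = concat (map U [0..<m]) @ u"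
  proof -
    have "U 0 @ concat (map (\<lambda>i. U (Suc i)) [0..<l]) = concat (map U [0..<l]) @ U l" for l
      by (induction l) simp_all
    from this[of m] show ?thesis
      using Um by (simp add: U_def)
  qed
  ultimately have "reduce (w @ u) = reduce (u @ (shift n ^^ h) w)"
    by (simp add: w)
  then show ?thesis
    using conjugate_cyclically_reduced assms u cyclically_reduced_funpow_shift by metis
qed

lemma take_drop_blocks:
  "m * K \<le> length w \<Longrightarrow> concat (map (\<lambda>i. take K (drop (i * K) w)) [0..<m]) = take (m * K) w"
proof (induction m)
  case (Suc m)
  then show ?case
    using take_add[of "m * K" K w] by (simp add: add.commute)
qed simp

text \<open>\<open>n div gcd n h\<close> is the additive order of \<open>h\<close> modulo
  \<open>n\<close>.\<close>

lemma div_gcd_dvd_iff: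
  fixes n h j :: nat
  assumes "n > 0"
  shows "n div gcd n h dvd j \<longleftrightarrow> n dvd h * j"
proof -
  obtain a b where ab: "n = a * gcd n h" "h = b * gcd n h" "coprime a b"
    using gcd_coprime_exists[of n h] assms by auto
  have g: "gcd n h > 0"
    using assms by simp
  have "n div gcd n h = a"
    using ab(1) g by (metis nonzero_mult_div_cancel_right not_gr_zero)
  moreover have "n dvd h * j \<longleftrightarrow> a * gcd n h dvd (b * j) * gcd n h"
    using ab(1,2) by (metis mult.assoc mult.commute)
  ultimately show ?thesis
    using ab(3) assms by (simp add: coprime_dvd_mult_right_iff)
qed

text \<open>The pairs \<open>(i, k)\<close> for which the shift by \<open>i\<close> equals the
  rotation by \<open>k\<close> are closed under addition, and \<open>k\<close> determines
  \<open>i\<close> modulo \<open>n\<close>. They are therefore governed by one pair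
  \<open>(h, K)\<close> with \<open>K\<close> least positive, and \<open>u\<close> is the prefix of
  length \<open>K\<close>.\<close>

lemma ex_admissible_gcd_dvd:
  assumes w: "w \<in> carrier (F n)" "w \<noteq> []" "\<not> proper_power (F n) w"
  shows "\<exists>u h. admissible n w (u, h) \<and> n div gcd n h * length u = length w \<and>
           (\<forall>i k. (shift n ^^ i) w = rotate k w \<longrightarrow> gcd n h dvd i)"
proof -
  define R where "R i k \<longleftrightarrow> (shift n ^^ i) w = rotate k w" for i k
  have letters: "fst ` set w \<subseteq> {..<n}"
    using w(1) by (rule letters_carrier)
  then have n: "n > 0"
    using w(2) by (cases w) auto
  have R_add: "R (i + j) (k + l)" if "R i k" "R j l" for i j k l
    using that by (simp add: R_def funpow_add funpow_shift_rotate rotate_rotate add.commute)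
  have R_mult: "R (i * j) (k * j)" if "R i k" for i j k
  proof (induction j)
    case 0
    show ?case by (simp add: R_def)
  qed (use R_add that in simp)
  have R_cong: "[i = j] (mod n)" if "R i k" "R j k" for i j k
    using that funpow_shift_eq_iff[OF letters w(2)] by (metis R_def)
  have R_0: "R 0 (length w)"
    by (simp add: R_def)
  define K where "K = (LEAST k. k > 0 \<and> (\<exists>i. R i k))"
  have "K > 0 \<and> (\<exists>i. R i K)"
    unfolding K_def by (rule LeastI[of _ "length w"]) (use w(2) R_0 in auto)
  then obtain h' where K: "K > 0" "R h' K"
    by blast
  \<comment> \<open>Admissibility asks for a shift below \<open>n\<close>.\<close>
  define h where "h = h' mod n"
  have h: "R h K"
    using K(2) funpow_shift_cong[OF letters, of h h'] by (simp add: R_def h_def)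
  have K_dvd: "K dvd k" if "R i k" for i k
  proof -
    define q r where "q = k div K" and "r = k mod K"
    \<comment> \<open>The factor \<open>q * (n - 1)\<close> stands in for \<open>-q\<close>, since
      \<open>n\<close> shifts are trivial. Up to a rotation fixing \<open>w\<close>, this subtracts
      \<open>q\<close> copies of \<open>(h, K)\<close> and leaves the remainder \<open>r\<close>,
      which minimality of \<open>K\<close> forces to be 0.\<close>
    have "R (h * (q * (n - 1)) + i) (K * (q * (n - 1)) + k)"
      using R_add R_mult h that by blast
    moreover have "K * (q * (n - 1)) + k = r + K * (q * n)"
      using n mult_div_mod_eq[of K k] by (cases n) (simp_all add: q_def r_def algebra_simps)
    moreover have "rotate (K * (q * n)) w = w"
    proof -
      have "rotate (K * (q * n)) w = (shift n ^^ (h * (q * n))) w"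
        using R_mult[OF h, of "q * n"] by (simp add: R_def)
      also have "\<dots> = w"
        using funpow_shift_cong[OF letters, of "h * (q * n)" 0] by (simp add: cong_0_iff)
      finally show ?thesis .
    qed
    ultimately have "R (h * (q * (n - 1)) + i) r"
      unfolding R_def by (metis rotate_rotate)
    moreover have "r < K"
      using K(1) by (simp add: r_def)
    ultimately have "r = 0"
      using not_less_Least[of r "\<lambda>k. k > 0 \<and> (\<exists>i. R i k)"] unfolding K_def by (metis gr0I)
    then show ?thesis
      by (simp add: r_def mod_eq_0_iff_dvd)
  qed
  have dvd_h: "gcd n h dvd i" if R: "R i k" for i k
  proof -
    obtain j where "k = K * j"
      using K_dvd[OF R] by blast
    then have "[i = h * j] (mod n)"
      using R_cong[OF R] R_mult[OF h, of j] by simp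
    then have "[i = h * j] (mod gcd n h)"
      by (rule cong_dvd_modulus_nat) simp
    then show ?thesis
      using cong_dvd_iff by fastforce
  qed
  define m where "m = length w div K"
  have len: "m * K = length w"
    using K_dvd[OF R_0] by (simp add: m_def)
  \<comment> \<open>Both numbers are the order of the same operation on \<open>w\<close>: the shift
    by \<open>h\<close> and the rotation by \<open>K\<close> agree. Primitivity of \<open>w\<close>
    makes the order of the rotation equal to \<open>m\<close>.\<close>
  have iff: "n div gcd n h dvd j \<longleftrightarrow> m dvd j" for j
  proof -
    have "n div gcd n h dvd j \<longleftrightarrow> n dvd h * j"
      by (rule div_gcd_dvd_iff[OF n])
    also have "\<dots> \<longleftrightarrow> (shift n ^^ (h * j)) w = w"
      using funpow_shift_eq_iff[OF letters w(2), of "h * j" 0] by (simp add: cong_0_iff)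
    also have "\<dots> \<longleftrightarrow> rotate (K * j) w = w"
      using R_mult[OF h, of j] by (simp add: R_def)
    also have "\<dots> \<longleftrightarrow> m * K dvd K * j"
      using rotate_eq_self_iff_dvd[OF w] len by simp
    also have "\<dots> \<longleftrightarrow> m dvd j"
      using K(1) by (simp add: mult.commute)
    finally show ?thesis .
  qed
  have m: "n div gcd n h = m"
    using iff[of m] iff[of "n div gcd n h"] by (simp add: dvd_antisym)
  \<comment> \<open>The shift by \<open>i * h\<close> rotates \<open>w\<close> by
    \<open>i * K\<close>, so it carries the first block to block \<open>i\<close>. The bound
    \<open>i < m\<close> keeps this block from wrapping around.\<close>
  have block: "(shift n ^^ (i * h)) (take K w) = take K (drop (i * K) w)" if "i < m" for i
  proof -
    have "Suc i * K \<le> m * K"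
      using that by (intro mult_right_mono) auto
    then have "i * K + K \<le> length w"
      using len by simp
    then have "take K (rotate (i * K) w) = take K (drop (i * K) w)"
      using K(1) by (simp add: rotate_drop_take)
    then show ?thesis
      using R_mult[OF h, of i] by (simp add: R_def funpow_shift_take mult.commute)
  qed
  have "shift_product n h (take K w) = reduce (concat (map (\<lambda>i. take K (drop (i * K) w)) [0..<m]))"
    unfolding shift_product_eq_reduce m
    by (intro arg_cong[where f = reduce] arg_cong[where f = concat] map_cong refl block) simp
  also have "\<dots> = w"
    using take_drop_blocks[of m K w] len reduced_carrier[OF w(1)] by (simp add: reduce_reduced)
  finally have "admissible n w (take K w, h)"
    using n by (simp add: admissible_def h_def)
  moreover have "length (take K w) = K"
    using len w(2) by (cases m) auto
  ultimately show ?thesis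
    using m len dvd_h unfolding R_def by metis
qed

text \<open>The shortest pair is compared with the one from \<open>ex_admissible_gcd_dvd\<close>:
  both gcds agree, which gives one direction. The other holds because multiples of
  \<open>gcd n h\<close> are multiples of \<open>h\<close> modulo \<open>n\<close>.\<close>

lemma minimal_admissible_dvd_iff:
  assumes w: "w \<in> carrier (F n)" "w \<noteq> []" "cyclically_reduced w" "\<not> proper_power (F n) w"
    and min: "is_arg_min (\<lambda>(u, h). length u) (admissible n w) (u, h)"
  shows "gcd n h dvd i \<longleftrightarrow> (\<exists>k. (shift n ^^ i) w = rotate k w)"
proof -
  have adm: "admissible n w (u, h)"
    using min by (simp add: is_arg_min_def)
  then have n: "n > 0"
    by (auto simp: admissible_def)
  obtain k where k: "(shift n ^^ h) w = rotate k w"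
    using admissible_imp_rotate[OF w(1-3) adm] by blast
  obtain u' h' where u': "admissible n w (u', h')" "n div gcd n h' * length u' = length w"
    and dvd: "\<And>i k. (shift n ^^ i) w = rotate k w \<Longrightarrow> gcd n h' dvd i"
    using ex_admissible_gcd_dvd[OF w(1,2,4)] by blast
  have le: "length u \<le> length u'"
    using min u'(1) by (force simp: is_arg_min_def not_less)
  have "gcd n h' dvd gcd n h"
    using dvd[OF k] by simp
  moreover have "gcd n h \<le> gcd n h'"
  proof -
    have "w = shift_product n h u"
      using adm by (simp add: admissible_def)
    \<comment> \<open>The left side is the length of \<open>w\<close>. Passing from \<open>u\<close>
      to the longer \<open>u'\<close> lets the positive factor \<open>length u'\<close> be
      cancelled.\<close>
    then have "n div gcd n h' * length u' \<le> n div gcd n h * length u"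
      using length_shift_product_le[of n h u] u'(2) by simp
    also have "\<dots> \<le> n div gcd n h * length u'"
      using le by simp
    finally have "n div gcd n h' \<le> n div gcd n h"
      using u'(2) w(2) by (metis length_greater_0_conv mult_0_right mult_le_cancel2 gr0I)
    moreover have "0 < n div gcd n h"
      using n by (simp add: div_greater_zero_iff dvd_imp_le)
    moreover have "n div gcd n h * gcd n h = n" "n div gcd n h' * gcd n h' = n"
      by simp_all
    ultimately show ?thesis
      by (metis mult_le_mono1 mult.commute nat_mult_le_cancel1)
  qed
  ultimately have eq: "gcd n h' = gcd n h"
    using n dvd_imp_le[of "gcd n h'" "gcd n h"] by (simp del: gcd_greatest_iff)
  show ?thesis
  proof
    assume "gcd n h dvd i"
    then obtain l where l: "i = gcd n h * l"
      by blast
    \<comment> \<open>Bezout coefficient of \<open>h\<close> modulo \<open>n\<close>.\<close>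
    obtain j where "[h * j = gcd h n] (mod n)"
      using cong_solve_nat by blast
    then have "[h * j * l = gcd h n * l] (mod n)"
      by (rule cong_scalar_right)
    then have j: "[h * (j * l) = i] (mod n)"
      by (simp add: l gcd.commute[of h] mult.assoc)
    have "(shift n ^^ (h * l)) w = rotate (k * l) w" for l
      by (induction l) (simp_all add: funpow_add k funpow_shift_rotate rotate_rotate add.commute)
    then have "(shift n ^^ i) w = rotate (k * (j * l)) w"
      using funpow_shift_cong[OF letters_carrier[OF w(1)] j] by simp
    then show "\<exists>k. (shift n ^^ i) w = rotate k w" ..
  qed (use dvd eq in auto)
qed

section \<open>Concise refinements\<close>

text \<open>The relators of index \<open>n - 1\<close> down to \<open>d\<close> are removed one at a
  time. The relator of index \<open>t\<close> is a rotation of the one of index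
  \<open>t mod d\<close>, which is still present.\<close>

lemma refinement_truncated_presentation:
  assumes w: "w \<in> carrier (F n)" "w \<noteq> []" and "0 < d" "d \<le> n"
    and rot: "\<And>i. d dvd i \<Longrightarrow> \<exists>k. (shift n ^^ i) w = rotate k w"
  shows "refinement (truncated_presentation n d w) (cyclic_presentation n w)"
proof -
  let ?T = "\<lambda>t. truncated_presentation n t w"
  have redundant: "removes_redundant (?T (Suc t)) (?T t)" if t: "d \<le> t" "t < n" for t
  proof -
    define r s where "r = (shift n ^^ t) w" and "s = (shift n ^^ (t mod d)) w"
    \<comment> \<open>Distinctness as words ensures that deleting \<open>r\<close> from the set of
      relators removes the index \<open>t\<close> alone.\<close>
    have ne: "(shift n ^^ i) w \<noteq> r" if "i < t" for i
      using that t funpow_shift_eq_iff[OF letters_carrier[OF w(1)] w(2), of i t]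
      by (simp add: r_def cong_def)
    have lt: "t mod d < t"
      using t \<open>0 < d\<close> by (meson mod_less_divisor order_less_le_trans)
    obtain k where k: "(shift n ^^ (d * (t div d))) w = rotate k w"
      using rot by (meson dvd_triv_left)
    have "r = (shift n ^^ (t mod d + d * (t div d))) w"
      by (simp add: r_def)
    also have "\<dots> = rotate k s"
      by (simp only: funpow_add comp_apply k funpow_shift_rotate s_def)
    finally have "cyclic_permutation r s"
      by (auto simp: cyclic_permutation_def)
    moreover have "s \<noteq> r"
      using ne[OF lt] by (simp add: s_def)
    moreover have "r \<in> relators (?T (Suc t))" "s \<in> relators (?T (Suc t))"
      using lt less_SucI by (auto simp: truncated_presentation_def r_def s_def)
    ultimately have "freely_redundant (?T (Suc t)) r"
      by (auto simp: freely_redundant_def)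
    moreover have "?T t = (?T (Suc t))\<lparr>relators := relators (?T (Suc t)) - {r}\<rparr>"
      using ne by (auto simp: truncated_presentation_def r_def less_Suc_eq)
    ultimately show ?thesis
      unfolding removes_redundant_def by blast
  qed
  have "removes_redundant\<^sup>*\<^sup>* (?T n) (?T d)"
    using \<open>d \<le> n\<close>
  proof (induction rule: inc_induct)
    case (step t)
    with redundant show ?case
      by (metis rtranclp.rtrancl_into_rtrancl)
  qed simp
  then show ?thesis
    by (simp add: refinement_def truncated_presentation_def cyclic_presentation_def)
qed

lemma funpow_shift_cancel:
  assumes "w \<in> carrier (F n)" "j \<le> n"
  shows "(shift n ^^ (n - j)) ((shift n ^^ j) w) = w"
proof -
  have "(shift n ^^ (n - j + j)) w = w"
    using funpow_shift_cong[OF letters_carrier[OF assms(1)], of n 0] assms(2) by (simp add: cong_def)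
  then show ?thesis
    by (simp only: funpow_add comp_apply)
qed

text \<open>A rotation between relators of indices \<open>i\<close> and \<open>j\<close> makes
  \<open>d\<close> divide their difference, impossible for distinct indices below \<open>d\<close>.
  A rotation to an inverse, shifted back to \<open>w\<close>, contradicts orientability.\<close>

lemma concise_truncated_presentation:
  assumes w: "w \<in> carrier (F n)" "w \<noteq> []" "orientable n w" and d: "d dvd n" "d \<le> n"
    and rot: "\<And>i k. (shift n ^^ i) w = rotate k w \<Longrightarrow> d dvd i"
  shows "concise (truncated_presentation n d w)"
  unfolding concise_def
proof (rule ballI, rule notI)
  let ?T = "truncated_presentation n d w"
  fix r assume r: "r \<in> relators ?T" and red: "freely_redundant ?T r"
  obtain i where i: "r = (shift n ^^ i) w" "i < d"
    using r by (auto simp: truncated_presentation_def)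
  have "reduce r \<noteq> []"
    using w(2) reduced_carrier[OF funpow_shift_carrier[OF w(1), of i]] letters_carrier[OF w(1)]
    by (simp add: i(1) reduce_reduced funpow_shift_eq_map)
  then obtain j where j: "j < d" "i \<noteq> j" and perm:
    "cyclic_permutation r ((shift n ^^ j) w) \<or> cyclic_permutation r (inv_word ((shift n ^^ j) w))"
    using red i by (auto simp: freely_redundant_def truncated_presentation_def)
  from perm show False
  proof
    assume "cyclic_permutation r ((shift n ^^ j) w)"
    then obtain k where "(shift n ^^ i) w = rotate k ((shift n ^^ j) w)"
      by (auto simp: cyclic_permutation_def i)
    \<comment> \<open>Shifting by \<open>n - j\<close> undoes the shift by \<open>j\<close> without
      negative exponents.\<close>
    then have "(shift n ^^ (n - j)) ((shift n ^^ i) w) = rotate k w"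
      using funpow_shift_cancel[OF w(1), of j] j d by (simp add: funpow_shift_rotate)
    then have "d dvd n - j + i"
      using rot by (simp add: funpow_add)
    then have "[n - j + i + j = j] (mod d)"
      by (simp add: cong_add_rcancel_0_nat cong_0_iff)
    moreover have "n - j + i + j = i + n"
      using j d by simp
    moreover have "[i + n = i] (mod d)"
      using d(1) by (simp add: cong_add_lcancel_0_nat cong_0_iff)
    ultimately have "[i = j] (mod d)"
      by (metis cong_sym cong_trans)
    then show False
      using i j by (simp add: cong_def)
  next
    assume "cyclic_permutation r (inv_word ((shift n ^^ j) w))"
    then obtain k where "(shift n ^^ i) w = rotate k (inv_word ((shift n ^^ j) w))"
      by (auto simp: cyclic_permutation_def i)
    then have "(shift n ^^ (n - i)) ((shift n ^^ i) w)
        = rotate k (inv_word ((shift n ^^ (n - i + j)) w))"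
      by (simp add: funpow_shift_rotate funpow_shift_inv_word funpow_add)
    then have "w = rotate k (inv_word ((shift n ^^ (n - i + j)) w))"
      using funpow_shift_cancel[OF w(1), of i] i d by simp
    \<comment> \<open>The exponent is reduced modulo \<open>n\<close> because orientability concerns
      shifts below \<open>n\<close>.\<close>
    then have "cyclic_permutation w (inv_word ((shift n ^^ ((n - i + j) mod n)) w))"
      using funpow_shift_cong[OF letters_carrier[OF w(1)], of "(n - i + j) mod n" "n - i + j"]
      by (auto simp: cyclic_permutation_def)
    moreover have "(n - i + j) mod n < n"
      using i d by simp
    ultimately show False
      using w(3) by (auto simp: orientable_def)
  qed
qed

theorem corollary3p3:
  fixes n h :: nat and w u :: "nat word"
  assumes "n \<ge> 1"
    and "w \<in> carrier (F n)"
    and "w \<noteq> []"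
    and "cyclically_reduced w"
    and "\<not> proper_power (F n) w"
    and "orientable n w"
    and "is_arg_min (\<lambda>(u, h). length u) (admissible n w) (u, h)"
  shows "concise_refinement (truncated_presentation n (gcd n h) w) (cyclic_presentation n w)"
proof -
  have "gcd n h dvd i \<longleftrightarrow> (\<exists>k. (shift n ^^ i) w = rotate k w)" for i
    using minimal_admissible_dvd_iff[OF assms(2-5,7)] .
  moreover have "0 < gcd n h" "gcd n h \<le> n"
    using assms(1) by (simp_all add: dvd_imp_le)
  ultimately show ?thesis
    unfolding concise_refinement_def
    using refinement_truncated_presentation concise_truncated_presentation assms
    by (metis gcd_dvd1)
qed

end
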